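(* Let $W\subset\mathbb{R}_+^m$ and $B\subset\mathbb{R}^{|S|}$ be finite classes and let $B_W>0$, $\delta\in(0,1)$. Assume: (i) (Single-policy concentrability) there are an optimal policy $\pi^*$ (a maximizer of $J_{\mu_0}$) and a constant $C^*>0$ with $\theta_{\pi^*,\mu_0}(s,a)\le C^*\mu(s,a)$ for all $(s,a)\in S\times A$; (ii) (realizability) $W$ contains an optimal solution $w^*$ of the linear program $\max_{w\ge 0}u^\top w$ s.t. $Kw=(1-\gamma)\mu_0$ with $\pi_{w^*}=\pi^*$, for the $\pi^*$ of (i); (iii) (completeness) $\phi(w)\in B$ for all $w\in W$, where $\phi(w)\in\arg\max_{\|x\|_\infty\le 1}x^\top(Kw-(1-\gamma)\mu_0)$; (iv) (boundedness) $w\ge 0$ and $\|w\|_\infty\le B_W$ for all $w\in W$, and $\|x\|_\infty\le 1$ for all $x\in B$. Let $E_{n,\delta}=\frac{2B_W\sqrt{2\log(|B||W|/\delta)}}{\sqrt n}$, let $w_{\mathcal D}$ be a solution of $$\max_{w\in W}\ u_{\mathcal D}^\top w\quad\text{s.t.}\quad x^\top\big(K_{\mathcal D}w-(1-\gamma)\mu_0\big)\le E_{n,\delta}\ \ \forall x\in B,$$ and let $\pi_{\mathcal D}=\pi_{w_{\mathcal D}}$. Then, with probability at least $1-6\delta$ over the dataset $\mathcal D$, $$J_{\mu_0}(\pi^* )-J_{\mu_0}(\pi_{\mathcal D})\le\frac{4\sqrt2\,B_W\sqrt{\log(|B||W|/\delta)}}{(1-\gamma)\sqrt n}.$$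
   Context: MDP: $S,A$ are finite, $m=|S||A|$, $r:S\times A\to[0,1]$ is the reward, $P_{s,a}\in\Delta(S)$ the transition probabilities, $\gamma\in[0,1)$, $\mu_0\in\Delta(S)$ the initial state distribution. A policy is a map $\pi:S\to\Delta(A)$. For $\rho\in\Delta(S)$ the discounted occupancy measure is $\theta_{\pi,\rho}(s,a)=(1-\gamma)\sum_{t\ge0}\gamma^t\,\mathbb P_\pi(s_t=s,a_t=a;\,s_0\sim\rho)$, and $J_\rho(\pi)=\sum_{s,a}r(s,a)\theta_{\pi,\rho}(s,a)$ (which equals $(1-\gamma)$ times the expected discounted return from $s_0\sim\rho$). Offline data: $\mathcal D=\{(s_i,a_i,s_i',r_i)\}_{i=1}^n$ are i.i.d. with $(s_i,a_i)\sim\mu\in\Delta(S\times A)$, $s_i'\sim P_{s_i,a_i}$, $r_i=r(s_i,a_i)$. Put $\mu(s)=\sum_a\mu(s,a)$, $\pi_\mu(a\mid s)=\mu(s,a)/\mu(s)$ if $\mu(s)>0$ and $\pi_\mu(a\mid s)=0$ for all $a$ otherwise; $\pi_\mu$ is known. Vectors/matrices: $u(s,a)=r(s,a)\mu(s,a)$; $u_{\mathcal D}^\top w=\frac1n\sum_i r_iw(s_i,a_i)$; $(Kw)(s)=\sum_a w(s,a)\mu(s,a)-\gamma\sum_{\bar s,a}P_{\bar s,a}(s)w(\bar s,a)\mu(\bar s,a)$; $(K_{\mathcal D}w)(s)=\frac1n\sum_{i=1}^n w(s_i,a_i)\big(\mathbf 1\{s_i=s\}-\gamma\mathbf 1\{s_i'=s\}\big)$.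 For $w\in\mathbb R_+^m$: $\pi_w(a\mid s)=\frac{w(s,a)\pi_\mu(a\mid s)}{\sum_{a'}w(s,a')\pi_\mu(a'\mid s)}$ if the denominator is positive, and $\pi_w(a\mid s)=1/|A|$ otherwise. *)

theory Defs
  imports "HOL-Analysis.Analysis" "HOL-Probability.Probability"
begin

text \<open>
  The state space and the action space are finite types \<open>'s\<close> and \<open>'a\<close>. Elements of simplices
  are probability mass functions, and vectors indexed by state-action pairs and by states have
  type \<open>real ^ ('s \<times> 'a)\<close> and \<open>real ^ 's\<close>.
\<close>

type_synonym ('s, 'a) policy = "'s \<Rightarrow> 'a pmf"
type_synonym ('s, 'a) sample = "'s \<times> 'a \<times> 's \<times> real"

text \<open>Law of \<open>(s\<^sub>t, a\<^sub>t)\<close> when \<open>s\<^sub>0\<close> has law \<open>\<rho>\<close>, actions follow \<open>\<pi>\<close> and transitions follow \<open>P\<close>.\<close>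

primrec state_action_law ::
  "('s \<Rightarrow> 'a \<Rightarrow> 's pmf) \<Rightarrow> 's pmf \<Rightarrow> ('s, 'a) policy \<Rightarrow> nat \<Rightarrow> ('s \<times> 'a) pmf" where
  "state_action_law P \<rho> \<pi> 0 = bind_pmf \<rho> (\<lambda>s. map_pmf (Pair s) (\<pi> s))"
| "state_action_law P \<rho> \<pi> (Suc t) =
     bind_pmf (state_action_law P \<rho> \<pi> t)
       (\<lambda>(s, a). bind_pmf (P s a) (\<lambda>s'. map_pmf (Pair s') (\<pi> s')))"

definition occupancy ::
  "('s \<Rightarrow> 'a \<Rightarrow> 's pmf) \<Rightarrow> real \<Rightarrow> 's pmf \<Rightarrow> ('s, 'a) policy \<Rightarrow> 's \<Rightarrow> 'a \<Rightarrow> real" where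
  "occupancy P \<gamma> \<rho> \<pi> s a =
     (1 - \<gamma>) * (\<Sum>t. \<gamma> ^ t * pmf (state_action_law P \<rho> \<pi> t) (s, a))"

definition policy_value ::
  "('s::finite \<Rightarrow> 'a::finite \<Rightarrow> real) \<Rightarrow> ('s \<Rightarrow> 'a \<Rightarrow> 's pmf) \<Rightarrow> real \<Rightarrow> 's pmf
     \<Rightarrow> ('s, 'a) policy \<Rightarrow> real" where
  "policy_value r P \<gamma> \<rho> \<pi> = (\<Sum>s\<in>UNIV. \<Sum>a\<in>UNIV. r s a * occupancy P \<gamma> \<rho> \<pi> s a)"

definition u_vec ::
  "('s::finite \<Rightarrow> 'a::finite \<Rightarrow> real) \<Rightarrow> ('s \<times> 'a) pmf \<Rightarrow> real ^ ('s \<times> 'a)" where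
  "u_vec r \<mu> = (\<chi> p. case p of (s, a) \<Rightarrow> r s a * pmf \<mu> (s, a))"

definition K_op ::
  "('s::finite \<Rightarrow> 'a::finite \<Rightarrow> 's pmf) \<Rightarrow> real \<Rightarrow> ('s \<times> 'a) pmf
     \<Rightarrow> real ^ ('s \<times> 'a) \<Rightarrow> real ^ 's" where
  "K_op P \<gamma> \<mu> w =
     (\<chi> s. (\<Sum>a\<in>UNIV. w $ (s, a) * pmf \<mu> (s, a))
         - \<gamma> * (\<Sum>s'\<in>UNIV. \<Sum>a\<in>UNIV. pmf (P s' a) s * w $ (s', a) * pmf \<mu> (s', a)))"

definition prob_vec :: "'s::finite pmf \<Rightarrow> real ^ 's" where
  "prob_vec \<rho> = (\<chi> s. pmf \<rho> s)"

definition sample_pmf ::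
  "('s \<Rightarrow> 'a \<Rightarrow> real) \<Rightarrow> ('s \<Rightarrow> 'a \<Rightarrow> 's pmf) \<Rightarrow> ('s \<times> 'a) pmf \<Rightarrow> ('s, 'a) sample pmf" where
  "sample_pmf r P \<mu> =
     bind_pmf \<mu> (\<lambda>(s, a). map_pmf (\<lambda>s'. (s, a, s', r s a)) (P s a))"

text \<open>
  A dataset of size \<open>n\<close> is a function on the indices \<open>{..<n}\<close>; the value \<open>undefined\<close> elsewhere
  is a dummy.
\<close>

definition dataset_pmf ::
  "('s \<Rightarrow> 'a \<Rightarrow> real) \<Rightarrow> ('s \<Rightarrow> 'a \<Rightarrow> 's pmf) \<Rightarrow> ('s \<times> 'a) pmf \<Rightarrow> nat
     \<Rightarrow> (nat \<Rightarrow> ('s, 'a) sample) pmf" where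
  "dataset_pmf r P \<mu> n = Pi_pmf {..<n} undefined (\<lambda>_. sample_pmf r P \<mu>)"

text \<open>The empirical linear functional \<open>w \<mapsto> u\<^sub>D\<^sup>T w\<close>.\<close>

definition u_emp ::
  "nat \<Rightarrow> (nat \<Rightarrow> ('s::finite, 'a::finite) sample) \<Rightarrow> real ^ ('s \<times> 'a) \<Rightarrow> real" where
  "u_emp n D w = 1 / real n * (\<Sum>i<n. case D i of (s, a, s', \<rho>) \<Rightarrow> \<rho> * w $ (s, a))"

definition K_emp ::
  "real \<Rightarrow> nat \<Rightarrow> (nat \<Rightarrow> ('s::finite, 'a::finite) sample) \<Rightarrow> real ^ ('s \<times> 'a) \<Rightarrow> real ^ 's" where
  "K_emp \<gamma> n D w =
     (\<chi> s. 1 / real n * (\<Sum>i<n. case D i of (s\<^sub>i, a\<^sub>i, s\<^sub>i', \<rho>) \<Rightarrow>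
        w $ (s\<^sub>i, a\<^sub>i) * (of_bool (s\<^sub>i = s) - \<gamma> * of_bool (s\<^sub>i' = s))))"

definition state_marginal :: "('s \<times> 'a::finite) pmf \<Rightarrow> 's \<Rightarrow> real" where
  "state_marginal \<mu> s = (\<Sum>a\<in>UNIV. pmf \<mu> (s, a))"

text \<open>
  The conditional law of the action. This is a real-valued function and not a policy, as it
  vanishes at states of mass zero.
\<close>

definition behavior :: "('s \<times> 'a::finite) pmf \<Rightarrow> 's \<Rightarrow> 'a \<Rightarrow> real" where
  "behavior \<mu> s a =
     (if state_marginal \<mu> s > 0 then pmf \<mu> (s, a) / state_marginal \<mu> s else 0)"

definition induced_prob ::
  "('s::finite \<times> 'a::finite) pmf \<Rightarrow> real ^ ('s \<times> 'a) \<Rightarrow> 's \<Rightarrow> 'a \<Rightarrow> real" where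
  "induced_prob \<mu> w s a =
     (if (\<Sum>a'\<in>UNIV. w $ (s, a') * behavior \<mu> s a') > 0
      then w $ (s, a) * behavior \<mu> s a / (\<Sum>a'\<in>UNIV. w $ (s, a') * behavior \<mu> s a')
      else 1 / real CARD('a))"

text \<open>Meaningful for \<open>w \<ge> 0\<close> only; see the lemma below.\<close>

definition induced_policy ::
  "('s::finite \<times> 'a::finite) pmf \<Rightarrow> real ^ ('s \<times> 'a) \<Rightarrow> ('s, 'a) policy" where
  "induced_policy \<mu> w s = embed_pmf (induced_prob \<mu> w s)"

lemma behavior_nonneg: "0 \<le> behavior \<mu> s a"
  by (simp add: behavior_def)

lemma pmf_induced_policy:
  fixes w :: "real ^ ('s::finite \<times> 'a::finite)"
  assumes "\<forall>p. 0 \<le> w $ p"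
  shows "pmf (induced_policy \<mu> w s) a = induced_prob \<mu> w s a"
proof -
  have nonneg: "0 \<le> induced_prob \<mu> w s b" for b
    using assms by (auto simp: induced_prob_def behavior_nonneg intro!: divide_nonneg_nonneg)
  have "(\<Sum>b\<in>UNIV. induced_prob \<mu> w s b) = 1"
    by (cases "(\<Sum>a'\<in>UNIV. w $ (s, a') * behavior \<mu> s a') > 0")
       (simp_all add: induced_prob_def sum_divide_distrib[symmetric])
  then have "(\<integral>\<^sup>+b. ennreal (induced_prob \<mu> w s b) \<partial>count_space UNIV) = 1"
    by (simp add: nn_integral_count_space_finite sum_ennreal nonneg)
  then show ?thesis
    unfolding induced_policy_def using nonneg by (intro pmf_embed_pmf) auto
qed

definition lp_solution ::
  "('s::finite \<Rightarrow> 'a::finite \<Rightarrow> real) \<Rightarrow> ('s \<Rightarrow> 'a \<Rightarrow> 's pmf) \<Rightarrow> real \<Rightarrow> 's pmf \<Rightarrow> ('s \<times> 'a) pmf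
     \<Rightarrow> real ^ ('s \<times> 'a) \<Rightarrow> bool" where
  "lp_solution r P \<gamma> \<mu>\<^sub>0 \<mu> =
     is_arg_max (\<lambda>w. u_vec r \<mu> \<bullet> w)
       (\<lambda>w. (\<forall>p. 0 \<le> w $ p) \<and> K_op P \<gamma> \<mu> w = (1 - \<gamma>) *\<^sub>R prob_vec \<mu>\<^sub>0)"

definition error_bound :: "real \<Rightarrow> ('v set) \<Rightarrow> ('x set) \<Rightarrow> nat \<Rightarrow> real \<Rightarrow> real" where
  "error_bound B\<^sub>W W B n \<delta> =
     2 * B\<^sub>W * sqrt (2 * ln (real (card B) * real (card W) / \<delta>)) / sqrt (real n)"

definition emp_solution ::
  "real \<Rightarrow> 's pmf \<Rightarrow> real \<Rightarrow> (real ^ ('s::finite \<times> 'a::finite)) set \<Rightarrow> (real ^ 's) set \<Rightarrow> nat \<Rightarrow> real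
     \<Rightarrow> (nat \<Rightarrow> ('s, 'a) sample) \<Rightarrow> real ^ ('s \<times> 'a) \<Rightarrow> bool" where
  "emp_solution \<gamma> \<mu>\<^sub>0 B\<^sub>W W B n \<delta> D =
     is_arg_max (u_emp n D)
       (\<lambda>w. w \<in> W \<and>
          (\<forall>x\<in>B. x \<bullet> (K_emp \<gamma> n D w - (1 - \<gamma>) *\<^sub>R prob_vec \<mu>\<^sub>0) \<le> error_bound B\<^sub>W W B n \<delta>))"

end

theory Submission
  imports Defs
begin

text \<open>
  Let \<open>V\<close> be the state value function of \<open>\<pi>\<^sub>w\<close>. Then
  \<open>u\<^sup>T w - J(\<pi>\<^sub>w) = V\<^sup>T (K w - (1 - \<gamma>) \<mu>\<^sub>0)\<close>, and since \<open>(1 - \<gamma>) V\<close> lies in the unit cube,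
  completeness bounds this by \<open>\<phi>(w)\<^sup>T (K w - (1 - \<gamma>) \<mu>\<^sub>0) / (1 - \<gamma>)\<close>; the right-hand side is
  controlled by the empirical constraint. For \<open>w\<^sup>*\<close> the difference vanishes.

  With \<open>L = log (|B||W| / \<delta>)\<close> and \<open>t = B\<^sub>W (L / (2 n))\<^bsup>1/2\<^esup>\<close>, the constraint slack is \<open>4 t\<close>.
  By Hoeffding and a union bound, with probability at least \<open>1 - 4 \<delta>\<close> all objectives deviate by
  less than \<open>t\<close> and all constraints by less than \<open>2 (1 + \<gamma>) t\<close>. Keeping the factor \<open>1 + \<gamma>\<close>
  instead of \<open>2\<close> is what makes the constant come out:
  \<open>2 t + (4 t + 2 (1 + \<gamma>) t) / (1 - \<gamma>) = 8 t / (1 - \<gamma>)\<close>.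
\<close>

section \<open>The state-action chain of a policy and its value functions\<close>

definition next_pmf ::
  "('s \<Rightarrow> 'a \<Rightarrow> 's pmf) \<Rightarrow> ('s, 'a) policy \<Rightarrow> 's \<times> 'a \<Rightarrow> ('s \<times> 'a) pmf" where
  "next_pmf P \<pi> = (\<lambda>(s, a). bind_pmf (P s a) (\<lambda>s'. map_pmf (Pair s') (\<pi> s')))"

text \<open>The backward operator of the chain: its \<open>t\<close>-th iterate on the reward is the
  expected reward \<open>t\<close> steps after a given pair.\<close>

definition next_exp ::
  "('s \<Rightarrow> 'a \<Rightarrow> 's pmf) \<Rightarrow> ('s, 'a) policy \<Rightarrow> ('s \<times> 'a \<Rightarrow> real) \<Rightarrow> 's \<times> 'a \<Rightarrow> real" where
  "next_exp P \<pi> g p = measure_pmf.expectation (next_pmf P \<pi> p) g"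

text \<open>The Q-function of \<pi>, as a series of iterates so that the Bellman equation becomes an
  index shift. Unlike \<open>policy_value\<close> it carries no factor 1 - \<gamma>.\<close>

definition action_value ::
  "('s \<Rightarrow> 'a \<Rightarrow> real) \<Rightarrow> ('s \<Rightarrow> 'a \<Rightarrow> 's pmf) \<Rightarrow> real \<Rightarrow> ('s, 'a) policy \<Rightarrow> 's \<times> 'a \<Rightarrow> real" where
  "action_value r P \<gamma> \<pi> p = (\<Sum>t. \<gamma> ^ t * (next_exp P \<pi> ^^ t) (\<lambda>(s, a). r s a) p)"

definition state_value ::
  "('s \<Rightarrow> 'a::finite \<Rightarrow> real) \<Rightarrow> ('s \<Rightarrow> 'a \<Rightarrow> 's pmf) \<Rightarrow> real \<Rightarrow> ('s, 'a) policy \<Rightarrow> 's \<Rightarrow> real" where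
  "state_value r P \<gamma> \<pi> s = (\<Sum>a\<in>UNIV. pmf (\<pi> s) a * action_value r P \<gamma> \<pi> (s, a))"

section \<open>Expectations as finite sums\<close>

lemma expectation_pmf_finite:
  fixes g :: "'a::finite \<Rightarrow> real"
  shows "measure_pmf.expectation p g = (\<Sum>x\<in>UNIV. pmf p x * g x)"
  by (subst integral_measure_pmf[of UNIV]) auto

lemma expectation_bind_pmf_finite:
  fixes p :: "'a::finite pmf" and g :: "'b \<Rightarrow> real"
  assumes "\<And>x. finite (set_pmf (f x))"
  shows "measure_pmf.expectation (bind_pmf p f) g =
    (\<Sum>x\<in>UNIV. pmf p x * measure_pmf.expectation (f x) g)"
  using pmf_expectation_bind[of UNIV f p g] assms by simp

lemma expectation_bind_Pair:
  fixes p :: "'a::finite pmf" and g :: "'a \<times> 'b::finite \<Rightarrow> real"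
  shows "measure_pmf.expectation (bind_pmf p (\<lambda>x. map_pmf (Pair x) (f x))) g =
    (\<Sum>x\<in>UNIV. pmf p x * (\<Sum>y\<in>UNIV. pmf (f x) y * g (x, y)))"
  by (subst expectation_bind_pmf_finite, simp, simp only: integral_map_pmf)
     (simp only: expectation_pmf_finite)

lemma sum_rotate:
  "(\<Sum>x\<in>A. \<Sum>y\<in>B. \<Sum>z\<in>C. f x y z) = (\<Sum>z\<in>C. \<Sum>x\<in>A. \<Sum>y\<in>B. f x y z)"
  by (simp only: sum.swap[of _ C B]) (rule sum.swap)

lemma expectation_pmf_finite_bounds:
  fixes g :: "'a::finite \<Rightarrow> real"
  assumes "\<And>x. l \<le> g x" "\<And>x. g x \<le> u"
  shows "l \<le> measure_pmf.expectation p g" "measure_pmf.expectation p g \<le> u"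
proof -
  have int: "integrable (measure_pmf p) g"
    by (rule integrable_measure_pmf_finite) simp
  show "l \<le> measure_pmf.expectation p g"
    by (rule measure_pmf.integral_ge_const[OF int]) (use assms in auto)
  show "measure_pmf.expectation p g \<le> u"
    by (rule measure_pmf.integral_le_const[OF int]) (use assms in auto)
qed

text \<open>Duality of the forward law and the backward operator: each time step of the law is
  traded for one application of \<open>next_exp\<close>. The induction varies \<open>g\<close>,
  since the peeled-off step turns \<open>g\<close> into \<open>next_exp P \<pi> g\<close>.\<close>

lemma expectation_state_action_law:
  fixes g :: "'s::finite \<times> 'a::finite \<Rightarrow> real"
  shows "measure_pmf.expectation (state_action_law P \<rho> \<pi> t) g =
    measure_pmf.expectation (state_action_law P \<rho> \<pi> 0) ((next_exp P \<pi> ^^ t) g)"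
proof (induction t arbitrary: g)
  case (Suc t)
  have "measure_pmf.expectation (state_action_law P \<rho> \<pi> (Suc t)) g =
      measure_pmf.expectation (bind_pmf (state_action_law P \<rho> \<pi> t) (next_pmf P \<pi>)) g"
    by (simp add: next_pmf_def)
  also have "\<dots> = measure_pmf.expectation (state_action_law P \<rho> \<pi> t) (next_exp P \<pi> g)"
    by (subst expectation_bind_pmf_finite) (simp_all add: expectation_pmf_finite next_exp_def)
  also have "\<dots> = measure_pmf.expectation (state_action_law P \<rho> \<pi> 0)
      ((next_exp P \<pi> ^^ t) (next_exp P \<pi> g))"
    by (rule Suc.IH)
  finally show ?case by (simp add: funpow_swap1)
qed simp

section \<open>Bounds, Bellman equation and policy value\<close>

context
  fixes r :: "'s::finite \<Rightarrow> 'a::finite \<Rightarrow> real"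
    and P :: "'s \<Rightarrow> 'a \<Rightarrow> 's pmf"
    and \<gamma> :: real
    and \<pi> :: "('s, 'a) policy"
  assumes reward: "\<And>s a. 0 \<le> r s a \<and> r s a \<le> 1"
    and discount: "0 \<le> \<gamma>" "\<gamma> < 1"
begin

text \<open>Averaging keeps values in the unit interval, where the reward starts.\<close>

lemma next_exp_funpow_bounds:
  "0 \<le> (next_exp P \<pi> ^^ t) (\<lambda>(s, a). r s a) p \<and> (next_exp P \<pi> ^^ t) (\<lambda>(s, a). r s a) p \<le> 1"
proof (induction t arbitrary: p)
  case 0
  then show ?case using reward by (cases p) auto
next
  case (Suc t)
  show ?case
    using Suc.IH unfolding funpow.simps comp_def next_exp_def[of P \<pi> "(next_exp P \<pi> ^^ t) _"]
    by (auto intro!: expectation_pmf_finite_bounds)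
qed

lemma summable_discounted:
  fixes f :: "nat \<Rightarrow> real"
  assumes "\<And>t. 0 \<le> f t \<and> f t \<le> 1"
  shows "summable (\<lambda>t. \<gamma> ^ t * f t)"
proof (rule summable_comparison_test')
  show "summable (\<lambda>t. \<gamma> ^ t)" using discount by (intro summable_geometric) auto
  show "norm (\<gamma> ^ t * f t) \<le> \<gamma> ^ t" if "t \<ge> 0" for t
    using assms[of t] discount by (simp add: abs_mult mult_left_le)
qed

lemma summable_action_value:
  "summable (\<lambda>t. \<gamma> ^ t * (next_exp P \<pi> ^^ t) (\<lambda>(s, a). r s a) p)"
  by (rule summable_discounted) (rule next_exp_funpow_bounds)

lemma action_value_bounds:
  "0 \<le> action_value r P \<gamma> \<pi> p" "action_value r P \<gamma> \<pi> p \<le> 1 / (1 - \<gamma>)"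
proof -
  show "0 \<le> action_value r P \<gamma> \<pi> p"
    unfolding action_value_def
    by (rule suminf_nonneg[OF summable_action_value])
       (use next_exp_funpow_bounds discount in auto)
  have "action_value r P \<gamma> \<pi> p \<le> (\<Sum>t. \<gamma> ^ t)"
    unfolding action_value_def
    by (rule suminf_le[OF _ summable_action_value summable_geometric])
       (use next_exp_funpow_bounds discount in \<open>auto simp: mult_left_le\<close>)
  then show "action_value r P \<gamma> \<pi> p \<le> 1 / (1 - \<gamma>)"
    using discount by (simp add: suminf_geometric)
qed

lemma state_value_bounds:
  "0 \<le> state_value r P \<gamma> \<pi> s" "state_value r P \<gamma> \<pi> s \<le> 1 / (1 - \<gamma>)"
  unfolding state_value_def expectation_pmf_finite[symmetric]
  by (rule expectation_pmf_finite_bounds; rule action_value_bounds)+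

lemma next_exp_action_value:
  "next_exp P \<pi> (action_value r P \<gamma> \<pi>) (s, a) =
     (\<Sum>s'\<in>UNIV. pmf (P s a) s' * state_value r P \<gamma> \<pi> s')"
  unfolding next_exp_def next_pmf_def prod.case state_value_def
  by (rule expectation_bind_Pair)

text \<open>The term at time 0 is the reward; the rest of the series is \<gamma> times the average
  of the same series at the next pair. Writing this average as a finite sum lets it pass through the
  series.\<close>

lemma action_value_Bellman:
  "action_value r P \<gamma> \<pi> (s, a) =
     r s a + \<gamma> * (\<Sum>s'\<in>UNIV. pmf (P s a) s' * state_value r P \<gamma> \<pi> s')"
proof -
  let ?R = "\<lambda>t. (next_exp P \<pi> ^^ t) (\<lambda>(s, a). r s a)"
  have "action_value r P \<gamma> \<pi> (s, a) = r s a + (\<Sum>t. \<gamma> ^ Suc t * ?R (Suc t) (s, a))"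
    unfolding action_value_def
    using suminf_split_head[OF summable_action_value[of "(s, a)"]] by simp
  also have "(\<Sum>t. \<gamma> ^ Suc t * ?R (Suc t) (s, a)) =
      (\<Sum>t. \<gamma> * (\<Sum>q\<in>UNIV. pmf (next_pmf P \<pi> (s, a)) q * (\<gamma> ^ t * ?R t q)))"
    by (simp add: next_exp_def[of P \<pi> "?R _"] expectation_pmf_finite sum_distrib_left mult_ac)
  also have "\<dots> = \<gamma> * (\<Sum>t. \<Sum>q\<in>UNIV. pmf (next_pmf P \<pi> (s, a)) q * (\<gamma> ^ t * ?R t q))"
    by (intro suminf_mult summable_sum summable_mult summable_action_value)
  also have "(\<Sum>t. \<Sum>q\<in>UNIV. pmf (next_pmf P \<pi> (s, a)) q * (\<gamma> ^ t * ?R t q)) =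
      (\<Sum>q\<in>UNIV. \<Sum>t. pmf (next_pmf P \<pi> (s, a)) q * (\<gamma> ^ t * ?R t q))"
    by (intro suminf_sum summable_mult summable_action_value)
  also have "\<dots> = next_exp P \<pi> (action_value r P \<gamma> \<pi>) (s, a)"
    unfolding next_exp_def[of P \<pi> "action_value r P \<gamma> \<pi>"] expectation_pmf_finite action_value_def
    by (intro sum.cong refl suminf_mult summable_action_value)
  finally show ?thesis by (simp add: next_exp_action_value)
qed

lemma policy_value_eq_state_value:
  "policy_value r P \<gamma> \<rho> \<pi> = (1 - \<gamma>) * (\<Sum>s\<in>UNIV. pmf \<rho> s * state_value r P \<gamma> \<pi> s)"
proof -
  let ?R = "\<lambda>t. (next_exp P \<pi> ^^ t) (\<lambda>(s, a). r s a)"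
  let ?L = "state_action_law P \<rho> \<pi>"
  have sm: "summable (\<lambda>t. \<gamma> ^ t * pmf (?L t) p)" for p
    by (rule summable_discounted) (simp add: pmf_le_1)
  have "policy_value r P \<gamma> \<rho> \<pi> =
      (\<Sum>p\<in>UNIV. (1 - \<gamma>) * (case_prod r p * (\<Sum>t. \<gamma> ^ t * pmf (?L t) p)))"
    by (simp add: policy_value_def occupancy_def sum.cartesian_product case_prod_unfold mult_ac)
  also have "\<dots> = (1 - \<gamma>) * (\<Sum>p\<in>UNIV. \<Sum>t. case_prod r p * (\<gamma> ^ t * pmf (?L t) p))"
    by (simp add: suminf_mult[OF sm] sum_distrib_left)
  also have "(\<Sum>p\<in>UNIV. \<Sum>t. case_prod r p * (\<gamma> ^ t * pmf (?L t) p)) =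
      (\<Sum>t. \<Sum>p\<in>UNIV. case_prod r p * (\<gamma> ^ t * pmf (?L t) p))"
    by (intro suminf_sum[symmetric] summable_mult sm)
  also have "\<dots> = (\<Sum>t. \<gamma> ^ t * measure_pmf.expectation (?L t) (case_prod r))"
    by (simp add: expectation_pmf_finite sum_distrib_left mult_ac)
  \<comment> \<open>With the dynamics moved from the law to the reward, time remains only in the
    iterates, and summing over \<open>t\<close> yields the action value.\<close>
  also have "\<dots> = (\<Sum>t. \<gamma> ^ t * measure_pmf.expectation (?L 0) (?R t))"
    by (subst expectation_state_action_law) simp
  also have "\<dots> = (\<Sum>t. \<Sum>p\<in>UNIV. pmf (?L 0) p * (\<gamma> ^ t * ?R t p))"
    by (simp add: expectation_pmf_finite sum_distrib_left mult_ac del: state_action_law.simps)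
  also have "\<dots> = (\<Sum>p\<in>UNIV. \<Sum>t. pmf (?L 0) p * (\<gamma> ^ t * ?R t p))"
    by (intro suminf_sum summable_mult summable_action_value)
  also have "\<dots> = measure_pmf.expectation (?L 0) (action_value r P \<gamma> \<pi>)"
    unfolding expectation_pmf_finite action_value_def
    by (intro sum.cong refl suminf_mult summable_action_value)
  also have "\<dots> = (\<Sum>s\<in>UNIV. pmf \<rho> s * state_value r P \<gamma> \<pi> s)"
    unfolding state_action_law.simps state_value_def by (rule expectation_bind_Pair)
  finally show ?thesis .
qed

end

section \<open>Weighted measures and their induced policies\<close>

text \<open>The measure \<open>w \<mu>\<close> disintegrates into its state marginal and the policy
  \<open>\<pi>\<^sub>w\<close>. The default values in \<open>behavior\<close> and
  \<open>induced_prob\<close> do no harm: where a normalizer is zero, both sides vanish.\<close>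

lemma weight_factorization:
  fixes w :: "real ^ ('s::finite \<times> 'a::finite)"
  assumes "\<And>p. 0 \<le> w $ p"
  shows "w $ (s, a) * pmf \<mu> (s, a) =
    (\<Sum>b\<in>UNIV. w $ (s, b) * pmf \<mu> (s, b)) * pmf (induced_policy \<mu> w s) a"
proof -
  define m where "m = state_marginal \<mu> s"
  have \<mu>_eq: "pmf \<mu> (s, b) = m * behavior \<mu> s b" for b
  proof (cases "m > 0")
    case False
    have "m \<ge> 0" by (simp add: m_def state_marginal_def sum_nonneg)
    with False have "m = 0" by simp
    then have "pmf \<mu> (s, b) = 0"
      using sum_nonneg_eq_0_iff[of UNIV "\<lambda>b. pmf \<mu> (s, b)"]
      by (auto simp: m_def state_marginal_def)
    with \<open>m = 0\<close> show ?thesis by simp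
  qed (simp add: behavior_def m_def)
  define Z where "Z = (\<Sum>b\<in>UNIV. w $ (s, b) * behavior \<mu> s b)"
  have sum_eq: "(\<Sum>b\<in>UNIV. w $ (s, b) * pmf \<mu> (s, b)) = m * Z"
    by (simp add: \<mu>_eq Z_def sum_distrib_left mult_ac)
  have term_nonneg: "0 \<le> w $ (s, b) * behavior \<mu> s b" for b
    using assms by (simp add: behavior_nonneg)
  have ind: "pmf (induced_policy \<mu> w s) a = induced_prob \<mu> w s a"
    by (rule pmf_induced_policy) (use assms in auto)
  show ?thesis
  proof (cases "Z > 0")
    case True
    then show ?thesis
      unfolding sum_eq ind by (simp add: induced_prob_def \<mu>_eq flip: Z_def)
  next
    case False
    moreover have "Z \<ge> 0" unfolding Z_def by (intro sum_nonneg term_nonneg)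
    ultimately have "Z = 0" by simp
    \<comment> \<open>Here the induced policy is uniform, but the state has weighted mass zero, so
      every summand of \<open>Z\<close> is zero as well.\<close>
    then have "w $ (s, a) * behavior \<mu> s a = 0"
      using sum_nonneg_eq_0_iff[of UNIV "\<lambda>b. w $ (s, b) * behavior \<mu> s b"] term_nonneg
      by (auto simp: Z_def)
    with \<open>Z = 0\<close> show ?thesis unfolding sum_eq by (auto simp: \<mu>_eq)
  qed
qed

text \<open>
  Unless \<open>K w = (1 - \<gamma>) \<mu>\<^sub>0\<close>, the weighted measure \<open>w \<mu>\<close> is not an occupancy measure, but it
  still satisfies the flow equation of \<open>\<pi>\<^sub>w\<close> with \<open>K w\<close> as its source. Pairing with the state
  values of \<open>\<pi>\<^sub>w\<close> therefore recovers its total reward.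
\<close>

lemma u_vec_eq_state_value_K_op:
  fixes w :: "real ^ ('s::finite \<times> 'a::finite)" and r :: "'s \<Rightarrow> 'a \<Rightarrow> real"
  assumes reward: "\<And>s a. 0 \<le> r s a \<and> r s a \<le> 1"
    and discount: "0 \<le> \<gamma>" "\<gamma> < 1"
    and nonneg: "\<And>p. 0 \<le> w $ p"
  shows "u_vec r \<mu> \<bullet> w =
    (\<chi> s. state_value r P \<gamma> (induced_policy \<mu> w) s) \<bullet> K_op P \<gamma> \<mu> w"
proof -
  let ?\<pi> = "induced_policy \<mu> w"
  let ?V = "state_value r P \<gamma> ?\<pi>" and ?Q = "action_value r P \<gamma> ?\<pi>"
  let ?\<nu> = "\<lambda>s a. w $ (s, a) * pmf \<mu> (s, a)"
  \<comment> \<open>By the factorization, averaging \<open>?Q\<close> against the weighted measure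
    at a state is averaging over the actions of \<open>\<pi>\<^sub>w\<close>, which gives
    \<open>?V\<close>.\<close>
  have V: "(\<Sum>a\<in>UNIV. ?\<nu> s a * ?Q (s, a)) = (\<Sum>a\<in>UNIV. ?\<nu> s a) * ?V s" for s
    unfolding state_value_def
    by (subst weight_factorization[OF nonneg]) (simp add: sum_distrib_left mult_ac)
  have "u_vec r \<mu> \<bullet> w = (\<Sum>s\<in>UNIV. \<Sum>a\<in>UNIV. ?\<nu> s a * r s a)"
    by (simp add: u_vec_def inner_vec_def sum.cartesian_product case_prod_unfold mult_ac)
  \<comment> \<open>The Bellman equation expresses the reward as the action value minus the
    discounted mean value of the next state.\<close>
  also have "\<dots> = (\<Sum>s\<in>UNIV. \<Sum>a\<in>UNIV. ?\<nu> s a * ?Q (s, a)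
      - \<gamma> * (\<Sum>s'\<in>UNIV. ?\<nu> s a * pmf (P s a) s' * ?V s'))"
    by (subst action_value_Bellman[OF reward discount]) (simp add: algebra_simps sum_distrib_left)
  also have "\<dots> = (\<Sum>s\<in>UNIV. (\<Sum>a\<in>UNIV. ?\<nu> s a) * ?V s)
      - \<gamma> * (\<Sum>s\<in>UNIV. \<Sum>a\<in>UNIV. \<Sum>s'\<in>UNIV. ?\<nu> s a * pmf (P s a) s' * ?V s')"
    by (simp add: sum_subtractf V sum_distrib_left)
  also have "(\<Sum>s\<in>UNIV. \<Sum>a\<in>UNIV. \<Sum>s'\<in>UNIV. ?\<nu> s a * pmf (P s a) s' * ?V s') =
      (\<Sum>s'\<in>UNIV. \<Sum>s\<in>UNIV. \<Sum>a\<in>UNIV. ?\<nu> s a * pmf (P s a) s' * ?V s')"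
    by (rule sum_rotate)
  also have "(\<Sum>s\<in>UNIV. (\<Sum>a\<in>UNIV. ?\<nu> s a) * ?V s) - \<gamma> * \<dots> = (\<chi> s. ?V s) \<bullet> K_op P \<gamma> \<mu> w"
    by (simp add: K_op_def inner_vec_def right_diff_distrib sum_subtractf sum_distrib_left mult_ac)
  finally show ?thesis .
qed

text \<open>Both terms are pairings with the same value vector: the objective pairs it with
  \<open>K w\<close>, the policy value with (1 - \<gamma>) times the initial distribution. The gap
  thus measures constraint violation.\<close>

lemma u_vec_minus_policy_value:
  fixes w :: "real ^ ('s::finite \<times> 'a::finite)" and r :: "'s \<Rightarrow> 'a \<Rightarrow> real"
  assumes reward: "\<And>s a. 0 \<le> r s a \<and> r s a \<le> 1"
    and discount: "0 \<le> \<gamma>" "\<gamma> < 1"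
    and nonneg: "\<And>p. 0 \<le> w $ p"
  shows "u_vec r \<mu> \<bullet> w - policy_value r P \<gamma> \<mu>\<^sub>0 (induced_policy \<mu> w) =
    (\<chi> s. state_value r P \<gamma> (induced_policy \<mu> w) s) \<bullet> (K_op P \<gamma> \<mu> w - (1 - \<gamma>) *\<^sub>R prob_vec \<mu>\<^sub>0)"
proof -
  have "policy_value r P \<gamma> \<mu>\<^sub>0 (induced_policy \<mu> w) =
      (\<chi> s. state_value r P \<gamma> (induced_policy \<mu> w) s) \<bullet> ((1 - \<gamma>) *\<^sub>R prob_vec \<mu>\<^sub>0)"
    unfolding policy_value_eq_state_value[OF reward discount]
    by (simp add: prob_vec_def inner_vec_def sum_distrib_left mult_ac)
  then show ?thesis
    by (simp add: inner_diff_right u_vec_eq_state_value_K_op[OF assms])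
qed

lemma infnorm_le_cart:
  fixes x :: "real ^ 'n"
  assumes "\<And>i. \<bar>x $ i\<bar> \<le> c"
  shows "infnorm x \<le> c"
  unfolding infnorm_cart by (rule cSup_least) (use assms in auto)

text \<open>After scaling by 1 - \<gamma> the value vector competes in the maximization over the
  unit cube; undoing the scaling costs the factor 1 / (1 - \<gamma>).\<close>

lemma state_value_inner_le:
  fixes d :: "real ^ 's::finite" and r :: "'s \<Rightarrow> 'a::finite \<Rightarrow> real"
  assumes reward: "\<And>s a. 0 \<le> r s a \<and> r s a \<le> 1"
    and discount: "0 \<le> \<gamma>" "\<gamma> < 1"
    and max: "is_arg_max (\<lambda>x. x \<bullet> d) (\<lambda>x. infnorm x \<le> 1) y"
  shows "(\<chi> s. state_value r P \<gamma> \<pi> s) \<bullet> d \<le> y \<bullet> d / (1 - \<gamma>)"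
proof -
  let ?V = "\<chi> s. state_value r P \<gamma> \<pi> s"
  have "\<bar>((1 - \<gamma>) *\<^sub>R ?V) $ s\<bar> \<le> 1" for s
  proof -
    have "0 \<le> state_value r P \<gamma> \<pi> s" "state_value r P \<gamma> \<pi> s \<le> 1 / (1 - \<gamma>)"
      by (rule state_value_bounds; fact)+
    then show ?thesis using discount by (simp add: abs_mult pos_le_divide_eq mult.commute)
  qed
  then have "infnorm ((1 - \<gamma>) *\<^sub>R ?V) \<le> 1"
    by (rule infnorm_le_cart)
  with max have "((1 - \<gamma>) *\<^sub>R ?V) \<bullet> d \<le> y \<bullet> d"
    by (auto simp: is_arg_max_linorder)
  with discount show ?thesis by (simp add: pos_le_divide_eq mult.commute)
qed

section \<open>Concentration of the empirical objective and constraints\<close>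

text \<open>The deviation level is chosen so that the exponent in Hoeffding's inequality is exactly
  \<open>- L\<close>; the factor 2 accounts for the two tails.\<close>

lemma Hoeffding_Pi_pmf:
  fixes f :: "'b \<Rightarrow> real" and p :: "'b pmf"
  assumes bounds: "\<And>x. x \<in> set_pmf p \<Longrightarrow> a \<le> f x \<and> f x \<le> b"
    and "a < b" "n > 0" "L \<ge> 0"
  shows "measure_pmf.prob (Pi_pmf {..<n} dflt (\<lambda>_. p))
    {D. \<bar>1 / real n * (\<Sum>i<n. f (D i)) - measure_pmf.expectation p f\<bar> \<ge> (b - a) * sqrt (L / (2 * real n))}
    \<le> 2 * exp (- L)"
proof -
  let ?M = "Pi_pmf {..<n} dflt (\<lambda>_. p)"
  let ?\<epsilon> = "(b - a) * sqrt (L / (2 * real n))"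
  have comp: "map_pmf (\<lambda>D. D i) ?M = p" if "i < n" for i
    using that by (simp add: Pi_pmf_component)
  have exp_comp: "measure_pmf.expectation ?M (\<lambda>D. f (D i)) = measure_pmf.expectation p f"
    if "i < n" for i
    using integral_map_pmf[of "\<lambda>D. D i" ?M f] comp[OF that] by simp
  interpret Hoeffding_ineq "measure_pmf ?M" "{..<n}" "\<lambda>i D. f (D i)" "\<lambda>_. a" "\<lambda>_. b"
    "\<Sum>i<n. measure_pmf.expectation ?M (\<lambda>D. f (D i))"
  proof unfold_locales
    show "prob_space.indep_vars (measure_pmf ?M) (\<lambda>_. borel) (\<lambda>i D. f (D i)) {..<n}"
      by (rule prob_space.indep_vars_compose2[OF prob_space_measure_pmf indep_vars_Pi_pmf]) auto
    show "AE D in measure_pmf ?M. f (D i) \<in> {a..b}" if "i \<in> {..<n}" for i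
    proof (subst AE_measure_pmf_iff, intro ballI)
      fix D assume "D \<in> set_pmf ?M"
      then have "D i \<in> set_pmf (map_pmf (\<lambda>D. D i) ?M)" by simp
      with that show "f (D i) \<in> {a..b}" using bounds by (simp add: comp)
    qed
  qed auto
  have mean: "(\<Sum>i<n. measure_pmf.expectation ?M (\<lambda>D. f (D i))) = real n * measure_pmf.expectation p f"
    by (simp add: exp_comp)
  have "{D. \<bar>1 / real n * (\<Sum>i<n. f (D i)) - measure_pmf.expectation p f\<bar> \<ge> ?\<epsilon>} =
      {D \<in> space (measure_pmf ?M).
        \<bar>(\<Sum>i<n. f (D i)) - (\<Sum>i<n. measure_pmf.expectation ?M (\<lambda>D. f (D i)))\<bar> \<ge> real n * ?\<epsilon>}"
  proof -
    have "(\<bar>1 / real n * y - e\<bar> \<ge> c) = (\<bar>y - real n * e\<bar> \<ge> real n * c)" for y e c :: real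
    proof -
      have "y - real n * e = real n * (1 / real n * y - e)"
        using \<open>n > 0\<close> by (simp add: field_simps)
      then show ?thesis using \<open>n > 0\<close> by (simp add: abs_mult)
    qed
    then show ?thesis unfolding mean by auto
  qed
  also have "measure_pmf.prob ?M \<dots> \<le> 2 * exp (- 2 * (real n * ?\<epsilon>)\<^sup>2 / (\<Sum>i<n. (b - a)\<^sup>2))"
    by (rule Hoeffding_ineq_abs_ge) (use assms in auto)
  also have "- 2 * (real n * ?\<epsilon>)\<^sup>2 / (\<Sum>i<n. (b - a)\<^sup>2) = - L"
  proof -
    have "(real n * ?\<epsilon>)\<^sup>2 = real n * (b - a)\<^sup>2 * (L / 2)"
      using assms by (simp add: power_mult_distrib power2_eq_square[of "real n"])
    then show ?thesis using assms by (simp only:) simp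
  qed
  finally show ?thesis .
qed

lemma expectation_sample_pmf:
  fixes h :: "('s::finite, 'a::finite) sample \<Rightarrow> real"
  shows "measure_pmf.expectation (sample_pmf r P \<mu>) h =
    (\<Sum>s\<in>UNIV. \<Sum>a\<in>UNIV. pmf \<mu> (s, a) * (\<Sum>s'\<in>UNIV. pmf (P s a) s' * h (s, a, s', r s a)))"
  unfolding sample_pmf_def
  by (subst expectation_bind_pmf_finite)
     (auto simp: sum.cartesian_product case_prod_unfold expectation_pmf_finite)

lemma u_vec_eq_expectation:
  fixes w :: "real ^ ('s::finite \<times> 'a::finite)"
  shows "measure_pmf.expectation (sample_pmf r P \<mu>) (\<lambda>(s, a, s', \<rho>). \<rho> * w $ (s, a)) =
    u_vec r \<mu> \<bullet> w"
  by (simp add: expectation_sample_pmf sum_pmf_eq_1 u_vec_def inner_vec_def sum.cartesian_product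
      case_prod_unfold mult_ac flip: sum_distrib_left)

text \<open>The contribution of one sample to the empirical pairing of \<open>x\<close> with
  \<open>K w\<close>: a weighted temporal difference of \<open>x\<close>. It makes that pairing a
  mean of i.i.d. terms.\<close>

definition residual_stat ::
  "real \<Rightarrow> real ^ ('s::finite \<times> 'a::finite) \<Rightarrow> real ^ 's \<Rightarrow> ('s, 'a) sample \<Rightarrow> real" where
  "residual_stat \<gamma> w x = (\<lambda>(s, a, s', \<rho>). w $ (s, a) * (x $ s - \<gamma> * x $ s'))"

lemma inner_K_emp:
  "x \<bullet> K_emp \<gamma> n D w = 1 / real n * (\<Sum>i<n. residual_stat \<gamma> w x (D i))"
proof -
  have delta: "(\<Sum>s\<in>UNIV. x $ s * of_bool (t = s)) = x $ t" for t
    by (simp add: of_bool_def if_distrib cong: if_cong)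
  have "(\<Sum>s\<in>UNIV. x $ s * (c * (f s - \<gamma> * g s))) =
      c * ((\<Sum>s\<in>UNIV. x $ s * f s) - \<gamma> * (\<Sum>s\<in>UNIV. x $ s * g s))" for c f g
    by (simp add: algebra_simps sum_subtractf sum_distrib_left)
  then have "(\<Sum>s\<in>UNIV. x $ s * (w $ (t, a) * (of_bool (t = s) - \<gamma> * of_bool (t' = s)))) =
      w $ (t, a) * (x $ t - \<gamma> * x $ t')" for t a t'
    by (simp only: delta)
  then have *: "(\<Sum>s\<in>UNIV. x $ s * (case d of (t, a, t', \<rho>) \<Rightarrow>
        w $ (t, a) * (of_bool (t = s) - \<gamma> * of_bool (t' = s)))) = residual_stat \<gamma> w x d" for d
    by (cases d) (simp add: residual_stat_def)
  have "x \<bullet> K_emp \<gamma> n D w = 1 / real n * (\<Sum>s\<in>UNIV. \<Sum>i<n. x $ s * (case D i of (t, a, t', \<rho>) \<Rightarrow>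
        w $ (t, a) * (of_bool (t = s) - \<gamma> * of_bool (t' = s))))"
    by (simp add: K_emp_def inner_vec_def sum_distrib_left mult_ac)
  also have "\<dots> = 1 / real n * (\<Sum>i<n. residual_stat \<gamma> w x (D i))"
    by (subst sum.swap) (simp only: *)
  finally show ?thesis .
qed

lemma inner_K_op_eq_expectation:
  "measure_pmf.expectation (sample_pmf r P \<mu>) (residual_stat \<gamma> w x) = x \<bullet> K_op P \<gamma> \<mu> w"
proof -
  \<comment> \<open>The weight and \<open>x $ s\<close> do not depend on the next state, so the
    transition probabilities in the first term sum to 1.\<close>
  have "measure_pmf.expectation (sample_pmf r P \<mu>) (residual_stat \<gamma> w x) =
      (\<Sum>s\<in>UNIV. \<Sum>a\<in>UNIV. pmf \<mu> (s, a) * w $ (s, a) *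
        (x $ s * (\<Sum>s'\<in>UNIV. pmf (P s a) s') - \<gamma> * (\<Sum>s'\<in>UNIV. pmf (P s a) s' * x $ s')))"
    by (simp add: expectation_sample_pmf residual_stat_def algebra_simps sum_subtractf
        sum_distrib_left)
  also have "\<dots> = (\<Sum>s\<in>UNIV. x $ s * (\<Sum>a\<in>UNIV. w $ (s, a) * pmf \<mu> (s, a)))
      - \<gamma> * (\<Sum>s\<in>UNIV. \<Sum>a\<in>UNIV. \<Sum>s'\<in>UNIV. x $ s' * (pmf (P s a) s' * w $ (s, a) * pmf \<mu> (s, a)))"
    by (simp add: sum_pmf_eq_1 algebra_simps sum_subtractf sum_distrib_left)
  also have "(\<Sum>s\<in>UNIV. \<Sum>a\<in>UNIV. \<Sum>s'\<in>UNIV. x $ s' * (pmf (P s a) s' * w $ (s, a) * pmf \<mu> (s, a))) =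
      (\<Sum>s'\<in>UNIV. \<Sum>s\<in>UNIV. \<Sum>a\<in>UNIV. x $ s' * (pmf (P s a) s' * w $ (s, a) * pmf \<mu> (s, a)))"
    by (rule sum_rotate)
  also have "(\<Sum>s\<in>UNIV. x $ s * (\<Sum>a\<in>UNIV. w $ (s, a) * pmf \<mu> (s, a))) - \<gamma> * \<dots> = x \<bullet> K_op P \<gamma> \<mu> w"
    by (simp add: K_op_def inner_vec_def right_diff_distrib sum_subtractf sum_distrib_left mult_ac)
  finally show ?thesis .
qed

lemma abs_residual_stat_le:
  assumes "0 \<le> \<gamma>" "\<And>p. \<bar>w $ p\<bar> \<le> c" "\<And>s. \<bar>x $ s\<bar> \<le> 1"
  shows "\<bar>residual_stat \<gamma> w x d\<bar> \<le> (1 + \<gamma>) * c"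
proof -
  obtain s a s' \<rho> where d: "d = (s, a, s', \<rho>)" by (cases d)
  have "\<gamma> * \<bar>x $ s'\<bar> \<le> \<gamma>" using assms by (simp add: mult_left_le)
  then have "\<bar>x $ s - \<gamma> * x $ s'\<bar> \<le> 1 + \<gamma>"
    using abs_triangle_ineq4[of "x $ s" "\<gamma> * x $ s'"] assms(1) assms(3)[of s]
    by (simp add: abs_mult)
  then have "\<bar>w $ (s, a)\<bar> * \<bar>x $ s - \<gamma> * x $ s'\<bar> \<le> c * (1 + \<gamma>)"
    using assms(2)[of "(s, a)"] by (intro mult_mono) auto
  then show ?thesis by (simp add: d residual_stat_def abs_mult mult_ac)
qed

text \<open>The statistic takes values between - (1 + \<gamma>) c and (1 + \<gamma>) c; the length
  of this interval gives the factor 2 (1 + \<gamma>).\<close>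

lemma K_emp_concentration:
  assumes "0 \<le> \<gamma>" "n > 0" "L \<ge> 0" "c > 0" "\<And>p. \<bar>w $ p\<bar> \<le> c" "\<And>s. \<bar>x $ s\<bar> \<le> 1"
  shows "measure_pmf.prob (dataset_pmf r P \<mu> n)
    {D. \<bar>x \<bullet> K_emp \<gamma> n D w - x \<bullet> K_op P \<gamma> \<mu> w\<bar> \<ge> 2 * (1 + \<gamma>) * (c * sqrt (L / (2 * real n)))}
    \<le> 2 * exp (- L)"
proof -
  have "(1 + \<gamma>) * c > 0" using assms by (intro mult_pos_pos) auto
  then show ?thesis
    using Hoeffding_Pi_pmf[of "sample_pmf r P \<mu>" "- ((1 + \<gamma>) * c)" "residual_stat \<gamma> w x"
        "(1 + \<gamma>) * c" n L undefined] assms abs_residual_stat_le[of \<gamma> w c x]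
    by (simp add: inner_K_emp inner_K_op_eq_expectation abs_le_iff minus_le_iff dataset_pmf_def
        algebra_simps)
qed

lemma u_emp_concentration:
  assumes "\<And>s a. 0 \<le> r s a \<and> r s a \<le> 1" "n > 0" "L \<ge> 0" "c > 0" "\<And>p. 0 \<le> w $ p \<and> w $ p \<le> c"
  shows "measure_pmf.prob (dataset_pmf r P \<mu> n)
    {D. \<bar>u_emp n D w - u_vec r \<mu> \<bullet> w\<bar> \<ge> c * sqrt (L / (2 * real n))} \<le> 2 * exp (- L)"
proof -
  have "0 \<le> r s a * w $ (s, a) \<and> r s a * w $ (s, a) \<le> c" for s a
    using mult_mono[of "r s a" 1 "w $ (s, a)" c] assms(1)[of s a] assms(5)[of "(s, a)"] assms(4)
    by simp
  \<comment> \<open>The reward entry of a sample can be any real by type; only on the support of the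
    law is it \<open>r s a\<close>, so the range is bounded there.\<close>
  then have "0 \<le> (case d of (s, a, s', \<rho>) \<Rightarrow> \<rho> * w $ (s, a)) \<and>
      (case d of (s, a, s', \<rho>) \<Rightarrow> \<rho> * w $ (s, a)) \<le> c" if "d \<in> set_pmf (sample_pmf r P \<mu>)" for d
    using that by (auto simp: sample_pmf_def)
  then show ?thesis
    using Hoeffding_Pi_pmf[of "sample_pmf r P \<mu>" 0 "\<lambda>(s, a, s', \<rho>). \<rho> * w $ (s, a)" c n L undefined]
      assms(2-4)
    by (simp add: u_emp_def u_vec_eq_expectation dataset_pmf_def)
qed

section \<open>Union bound and suboptimality estimate\<close>

theorem theorem1:
  fixes r :: "'s::finite \<Rightarrow> 'a::finite \<Rightarrow> real"
    and P :: "'s \<Rightarrow> 'a \<Rightarrow> 's pmf"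
    and \<gamma> \<delta> B\<^sub>W C :: real
    and \<mu>\<^sub>0 :: "'s pmf"
    and \<mu> :: "('s \<times> 'a) pmf"
    and n :: nat
    and W :: "(real ^ ('s \<times> 'a)) set"
    and B :: "(real ^ 's) set"
    and \<pi>_opt :: "('s, 'a) policy"
    and w_opt :: "real ^ ('s \<times> 'a)"
    and \<phi> :: "real ^ ('s \<times> 'a) \<Rightarrow> real ^ 's"
    and w\<^sub>D :: "(nat \<Rightarrow> ('s, 'a) sample) \<Rightarrow> real ^ ('s \<times> 'a)"
  assumes reward: "\<And>s a. 0 \<le> r s a \<and> r s a \<le> 1"
    and discount: "0 \<le> \<gamma>" "\<gamma> < 1"
    and sample_size: "n \<ge> 1"
    and finite_classes: "finite W" "finite B"
    and B\<^sub>W_pos: "B\<^sub>W > 0"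
    and confidence: "0 < \<delta>" "\<delta> < 1"
    and optimal: "is_arg_max (policy_value r P \<gamma> \<mu>\<^sub>0) (\<lambda>_. True) \<pi>_opt"
    and C_pos: "C > 0"
    and concentrability: "\<And>s a. occupancy P \<gamma> \<mu>\<^sub>0 \<pi>_opt s a \<le> C * pmf \<mu> (s, a)"
    and realizable: "w_opt \<in> W" "lp_solution r P \<gamma> \<mu>\<^sub>0 \<mu> w_opt"
      "induced_policy \<mu> w_opt = \<pi>_opt"
    and completeness:
      "\<And>w. w \<in> W \<Longrightarrow> is_arg_max (\<lambda>x. x \<bullet> (K_op P \<gamma> \<mu> w - (1 - \<gamma>) *\<^sub>R prob_vec \<mu>\<^sub>0))
                          (\<lambda>x. infnorm x \<le> 1) (\<phi> w)"
      "\<And>w. w \<in> W \<Longrightarrow> \<phi> w \<in> B"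
    and boundedness_W: "\<And>w p. w \<in> W \<Longrightarrow> 0 \<le> w $ p" "\<And>w. w \<in> W \<Longrightarrow> infnorm w \<le> B\<^sub>W"
    and boundedness_B: "\<And>x. x \<in> B \<Longrightarrow> infnorm x \<le> 1"
    and estimator: "\<And>D. \<exists>w. emp_solution \<gamma> \<mu>\<^sub>0 B\<^sub>W W B n \<delta> D w \<Longrightarrow>
                          emp_solution \<gamma> \<mu>\<^sub>0 B\<^sub>W W B n \<delta> D (w\<^sub>D D)"
  shows "measure_pmf.prob (dataset_pmf r P \<mu> n)
           {D. policy_value r P \<gamma> \<mu>\<^sub>0 \<pi>_opt - policy_value r P \<gamma> \<mu>\<^sub>0 (induced_policy \<mu> (w\<^sub>D D))
                \<le> 4 * sqrt 2 * B\<^sub>W * sqrt (ln (real (card B) * real (card W) / \<delta>))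
                   / ((1 - \<gamma>) * sqrt (real n))}
         \<ge> 1 - 6 * \<delta>"
proof -
  define N where "N = real (card B) * real (card W)"
  define L where "L = ln (N / \<delta>)"
  define t where "t = B\<^sub>W * sqrt (L / (2 * real n))"
  \<comment> \<open>\<open>w_opt\<close> and its image under \<open>\<phi>\<close> witness that both
    classes are nonempty. This gives \<open>N \<ge> 1\<close> and hence
    \<open>L \<ge> 0\<close>.\<close>
  have "W \<noteq> {}" "B \<noteq> {}"
    using realizable(1) completeness(2)[OF realizable(1)] by auto
  then have "card B \<ge> 1" "card W \<ge> 1"
    using finite_classes by (simp_all add: Suc_le_eq card_gt_0_iff)
  then have "1 * 1 \<le> N" unfolding N_def by (intro mult_mono) auto
  then have N: "1 \<le> N" by simp
  have "1 \<le> N / \<delta>" using N confidence by (simp add: field_simps)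
  then have L: "0 \<le> L" by (simp add: L_def)
  have exp_L: "exp (- L) = \<delta> / N" using N confidence by (simp add: L_def exp_minus)
  have t_eq: "sqrt 2 * B\<^sub>W * sqrt L / sqrt (real n) = 2 * t"
  proof -
    have "2 * t = (2 / sqrt 2) * B\<^sub>W * sqrt L / sqrt (real n)"
      by (simp add: t_def real_sqrt_divide real_sqrt_mult)
    then show ?thesis by (simp add: real_div_sqrt)
  qed
  have E: "error_bound B\<^sub>W W B n \<delta> = 4 * t"
  proof -
    have "error_bound B\<^sub>W W B n \<delta> = 2 * (sqrt 2 * B\<^sub>W * sqrt L / sqrt (real n))"
      by (simp add: error_bound_def real_sqrt_mult L_def N_def)
    then show ?thesis unfolding t_eq by simp
  qed
  have target: "4 * sqrt 2 * B\<^sub>W * sqrt (ln (real (card B) * real (card W) / \<delta>))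
      / ((1 - \<gamma>) * sqrt (real n)) = 8 * t / (1 - \<gamma>)"
  proof -
    have "4 * sqrt 2 * B\<^sub>W * sqrt L / ((1 - \<gamma>) * sqrt (real n)) =
        4 * (sqrt 2 * B\<^sub>W * sqrt L / sqrt (real n)) / (1 - \<gamma>)"
      by (simp add: mult_ac)
    then show ?thesis unfolding t_eq by (simp add: L_def N_def)
  qed
  have w_le: "w $ p \<le> B\<^sub>W" "\<bar>w $ p\<bar> \<le> B\<^sub>W" if "w \<in> W" for w p
    using boundedness_W(2)[OF that] component_le_infnorm_cart[of w p] by linarith+
  have x_le: "\<bar>x $ s\<bar> \<le> 1" if "x \<in> B" for x s
    using boundedness_B[OF that] component_le_infnorm_cart[of x s] by linarith

  let ?M = "dataset_pmf r P \<mu> n"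
  \<comment> \<open>The objective event is indexed by pairs too, although it only involves
    \<open>w\<close>. Each pair then has failure probability at most 4 \<delta> / N, and the
    \<open>N\<close> pairs together 4 \<delta>.\<close>
  define bad where "bad = (\<lambda>(x, w).
    {D. \<bar>x \<bullet> K_emp \<gamma> n D w - x \<bullet> K_op P \<gamma> \<mu> w\<bar> \<ge> 2 * (1 + \<gamma>) * t} \<union>
    {D. \<bar>u_emp n D w - u_vec r \<mu> \<bullet> w\<bar> \<ge> t})"
  have bad_le: "measure_pmf.prob ?M (bad q) \<le> 4 * \<delta> / N" if q_mem: "q \<in> B \<times> W" for q
  proof -
    obtain x w where q: "q = (x, w)" "x \<in> B" "w \<in> W" using q_mem by auto
    have "measure_pmf.prob ?M (bad q) \<le> 2 * exp (- L) + 2 * exp (- L)"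
      unfolding bad_def q prod.case t_def
      by (intro order_trans[OF measure_Un_le] add_mono K_emp_concentration u_emp_concentration)
         (use q reward discount sample_size L B\<^sub>W_pos w_le x_le boundedness_W(1) in auto)
    then show ?thesis by (simp add: exp_L)
  qed
  have "measure_pmf.prob ?M (\<Union>q\<in>B \<times> W. bad q) \<le> (\<Sum>q\<in>B \<times> W. measure_pmf.prob ?M (bad q))"
    using finite_classes by (intro measure_pmf.finite_measure_subadditive_finite) auto
  also have "\<dots> \<le> (\<Sum>q\<in>B \<times> W. 4 * \<delta> / N)"
    by (intro sum_mono bad_le)
  also have "\<dots> = 4 * \<delta>"
  proof -
    have "real (card (B \<times> W)) = N" by (simp add: N_def card_cartesian_product)
    then show ?thesis using N by simp
  qed
  finally have "1 - 4 * \<delta> \<le> measure_pmf.prob ?M (UNIV - (\<Union>q\<in>B \<times> W. bad q))"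
    using measure_pmf.prob_compl[of "\<Union>q\<in>B \<times> W. bad q" ?M] by simp
  also have "\<dots> \<le> measure_pmf.prob ?M {D. policy_value r P \<gamma> \<mu>\<^sub>0 \<pi>_opt
      - policy_value r P \<gamma> \<mu>\<^sub>0 (induced_policy \<mu> (w\<^sub>D D)) \<le> 8 * t / (1 - \<gamma>)}"
  proof (rule measure_pmf.finite_measure_mono)
    show "UNIV - (\<Union>q\<in>B \<times> W. bad q) \<subseteq> {D. policy_value r P \<gamma> \<mu>\<^sub>0 \<pi>_opt
      - policy_value r P \<gamma> \<mu>\<^sub>0 (induced_policy \<mu> (w\<^sub>D D)) \<le> 8 * t / (1 - \<gamma>)}"
    proof safe
      fix D assume good: "D \<notin> (\<Union>q\<in>B \<times> W. bad q)"
      let ?b = "(1 - \<gamma>) *\<^sub>R prob_vec \<mu>\<^sub>0"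
      let ?feas = "\<lambda>w. w \<in> W \<and> (\<forall>x\<in>B. x \<bullet> (K_emp \<gamma> n D w - ?b) \<le> error_bound B\<^sub>W W B n \<delta>)"
      have K_dev: "\<bar>x \<bullet> K_emp \<gamma> n D w - x \<bullet> K_op P \<gamma> \<mu> w\<bar> < 2 * (1 + \<gamma>) * t"
        if "x \<in> B" "w \<in> W" for x w
        using good that by (force simp: bad_def not_le)
      \<comment> \<open>Some member of \<open>B\<close> has to be paired with \<open>w\<close>;
        \<open>\<phi> w\<close> is one.\<close>
      have u_dev: "\<bar>u_emp n D w - u_vec r \<mu> \<bullet> w\<bar> < t" if "w \<in> W" for w
        using good that completeness(2)[OF that] by (force simp: bad_def not_le)
      have t: "0 \<le> t" using L B\<^sub>W_pos by (simp add: t_def)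
      have K_opt: "K_op P \<gamma> \<mu> w_opt = ?b"
        using realizable(2) by (simp add: lp_solution_def is_arg_max_def)
      have feas_opt: "?feas w_opt"
      proof (intro conjI ballI realizable(1))
        fix x assume "x \<in> B"
        have "x \<bullet> (K_emp \<gamma> n D w_opt - ?b) < 2 * (1 + \<gamma>) * t"
          using K_dev[OF \<open>x \<in> B\<close> realizable(1)] by (simp add: K_opt inner_diff_right)
        \<comment> \<open>Since 1 + \<gamma> \<le> 2, the constraint slack absorbs the deviation and
          \<open>w_opt\<close> stays feasible for the empirical problem.\<close>
        also have "\<dots> \<le> 4 * t" using t discount by (intro mult_right_mono) auto
        finally show "x \<bullet> (K_emp \<gamma> n D w_opt - ?b) \<le> error_bound B\<^sub>W W B n \<delta>" by (simp add: E)
      qed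
      \<comment> \<open>\<open>estimator\<close> only constrains \<open>w\<^sub>D D\<close> when a
        solution exists. On the good event one does, because the feasible set is finite and contains
        \<open>w_opt\<close>.\<close>
      have "finite {w. ?feas w}" using finite_classes(1) by simp
      then obtain w where "is_arg_max (u_emp n D) ?feas w"
        using feas_opt ex_is_arg_min_if_finite[of "{w. ?feas w}" "\<lambda>w. - u_emp n D w"]
        by (auto simp: is_arg_min_def is_arg_max_def)
      then have "emp_solution \<gamma> \<mu>\<^sub>0 B\<^sub>W W B n \<delta> D (w\<^sub>D D)"
        by (intro estimator exI[of _ w]) (simp add: emp_solution_def)
      then have wD: "is_arg_max (u_emp n D) ?feas (w\<^sub>D D)"
        by (simp add: emp_solution_def)
      then have wD_W: "w\<^sub>D D \<in> W" by (simp add: is_arg_max_def)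
      have u_le: "u_emp n D w_opt \<le> u_emp n D (w\<^sub>D D)"
        using wD feas_opt by (auto simp: is_arg_max_linorder)
      let ?d = "K_op P \<gamma> \<mu> (w\<^sub>D D) - ?b" and ?x = "\<phi> (w\<^sub>D D)"
      have "?x \<bullet> (K_emp \<gamma> n D (w\<^sub>D D) - ?b) \<le> 4 * t"
        using wD completeness(2)[OF wD_W] by (simp add: is_arg_max_def E)
      \<comment> \<open>The empirical constraint is passed to the population at the maximizer
        \<open>?x\<close>. As \<open>w\<^sub>D D\<close> and \<open>?x\<close> depend on the data,
        this uses that the deviation bound is uniform over both classes.\<close>
      then have d_le: "?x \<bullet> ?d \<le> 4 * t + 2 * (1 + \<gamma>) * t"
        using K_dev[OF completeness(2)[OF wD_W] wD_W] by (simp add: inner_diff_right)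
      have "u_vec r \<mu> \<bullet> w\<^sub>D D - policy_value r P \<gamma> \<mu>\<^sub>0 (induced_policy \<mu> (w\<^sub>D D)) \<le> ?x \<bullet> ?d / (1 - \<gamma>)"
        unfolding u_vec_minus_policy_value[OF reward discount boundedness_W(1)[OF wD_W]]
        by (rule state_value_inner_le[OF reward discount completeness(1)[OF wD_W]])
      also have "\<dots> \<le> (4 * t + 2 * (1 + \<gamma>) * t) / (1 - \<gamma>)"
        using d_le discount by (intro divide_right_mono) auto
      finally have gap_D: "u_vec r \<mu> \<bullet> w\<^sub>D D - policy_value r P \<gamma> \<mu>\<^sub>0 (induced_policy \<mu> (w\<^sub>D D)) \<le> \<dots>" .
      have gap_opt: "policy_value r P \<gamma> \<mu>\<^sub>0 \<pi>_opt = u_vec r \<mu> \<bullet> w_opt"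
      proof -
        have "u_vec r \<mu> \<bullet> w_opt - policy_value r P \<gamma> \<mu>\<^sub>0 (induced_policy \<mu> w_opt) =
            (\<chi> s. state_value r P \<gamma> (induced_policy \<mu> w_opt) s) \<bullet> (K_op P \<gamma> \<mu> w_opt - ?b)"
          by (rule u_vec_minus_policy_value[OF reward discount boundedness_W(1)[OF realizable(1)]])
        then show ?thesis by (simp add: K_opt realizable(3))
      qed
      \<comment> \<open>Empirical optimality of \<open>w\<^sub>D D\<close> against the feasible
        \<open>w_opt\<close>, with one deviation \<open>t\<close> for each of the two
        objectives.\<close>
      have "u_vec r \<mu> \<bullet> w_opt - u_vec r \<mu> \<bullet> w\<^sub>D D \<le> 2 * t"
        using u_le u_dev[OF realizable(1)] u_dev[OF wD_W] by linarith
      with gap_D gap_opt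
      have "policy_value r P \<gamma> \<mu>\<^sub>0 \<pi>_opt - policy_value r P \<gamma> \<mu>\<^sub>0 (induced_policy \<mu> (w\<^sub>D D))
          \<le> 2 * t + (4 * t + 2 * (1 + \<gamma>) * t) / (1 - \<gamma>)" by linarith
      \<comment> \<open>Over the common denominator the terms -2 \<gamma> t and +2 \<gamma> t
        cancel.\<close>
      also have "\<dots> = 8 * t / (1 - \<gamma>)"
        using discount by (simp add: field_simps)
      finally show "policy_value r P \<gamma> \<mu>\<^sub>0 \<pi>_opt
          - policy_value r P \<gamma> \<mu>\<^sub>0 (induced_policy \<mu> (w\<^sub>D D)) \<le> 8 * t / (1 - \<gamma>)" .
    qed
  qed simp
  \<comment> \<open>The bound 1 - 4 \<delta> exceeds the required 1 - 6 \<delta>, as \<delta> is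
    positive.\<close>
  finally show ?thesis unfolding target using confidence by simp
qed

end
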